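(* For each $\epsilon>0$ there is $x_0(\epsilon)$ such that for all $x>x_0(\epsilon)$, the number of anti-elite integers $A\in(1,x]$ is $O_{\epsilon}\big(x/(\log x)^{1-\epsilon}\big)$.
   Context: $F_n=2^{2^n}+1$ denotes the $n$th Fermat number, and $\left(\frac{\cdot}{\cdot}\right)$ is the Jacobi symbol. A positive integer $A$ is called anti-elite if $\left(\frac{A}{F_n}\right)=1$ for all sufficiently large positive integers $n$. *)

theory Defs
  imports Complex_Main "HOL-Number_Theory.Number_Theory"
begin

definition fermat_number :: "nat \<Rightarrow> nat" where
  "fermat_number n = 2 ^ (2 ^ n) + 1"

text \<open>The modulus \<open>m\<close> is meant to be odd and positive; nothing is claimed about the
  value at other \<open>m\<close>.\<close>

definition jacobi :: "int \<Rightarrow> nat \<Rightarrow> int" where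
  "jacobi a m = (\<Prod>p\<in>#prime_factorization m. Legendre a (int p))"

definition anti_elite :: "nat \<Rightarrow> bool" where
  "anti_elite A \<longleftrightarrow> A > 0 \<and> (\<forall>\<^sub>F n in sequentially. jacobi (int A) (fermat_number n) = 1)"

end

(*
  For an odd prime p the symbol (p/F_n) = (F_n/p) is periodic in n from the 2-adic valuation of
  p - 1 on. Hence if A is anti-elite and k is the largest of the valuations of p - 1 over the odd
  primes p dividing A, then (A/F_n) = 1 for all n > k. Since (3/F_n) = -1, each such condition
  cuts the residues modulo F_n by half, and the F_n are coprime; so at most O(2^k 2^y / y) of the
  m < 2^y have (m/F_n) prescribed for all n > k.

  Write A = p m with p of the largest valuation k. For p between 2^i and 2^(i+1) and A <= 2^X,
  there are O(2^k 2^(X-i) / (X-i)) choices of m, and O(k 2^(i-k) / i) choices of p by a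
  Chebyshev estimate in the progression 1 modulo 2^k. The powers of 2 cancel, and summing over i
  and over k < K gives O(K^2 2^X log X / X). The A with a prime factor p = 1 modulo 2^K number
  only O(X 2^(X-K)), and 2^K of size X^2 leaves 2^X (log X)^3 / X in total.
*)

theory Submission
  imports Defs "HOL-Real_Asymp.Real_Asymp"
begin

section \<open>Multiplicativity of the Legendre and Jacobi symbols\<close>

text \<open>By Euler's criterion both sides are congruent modulo \<open>q\<close>; they differ by at
  most 2, and \<open>q > 2\<close>.\<close>

lemma Legendre_mult:
  assumes "prime q" "2 < (q::nat)"
  shows "Legendre (a * b) (int q) = Legendre a (int q) * Legendre b (int q)"
proof -
  let ?L = "\<lambda>a. Legendre a (int q)"
  have "[?L (a * b) = (a * b) ^ ((q - 1) div 2)] (mod int q)"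
    by (rule euler_criterion[OF assms])
  moreover have "[?L a * ?L b = a ^ ((q - 1) div 2) * b ^ ((q - 1) div 2)] (mod int q)"
    by (intro cong_mult euler_criterion[OF assms])
  ultimately have c: "[?L (a * b) = ?L a * ?L b] (mod int q)"
    by (metis cong_sym cong_trans power_mult_distrib)
  have "int q dvd ?L (a * b) - ?L a * ?L b"
    using c by (simp add: cong_iff_dvd_diff)
  moreover have "\<bar>?L (a * b) - ?L a * ?L b\<bar> \<le> 2"
    by (auto simp: Legendre_def)
  ultimately show ?thesis
    using assms(2) zdvd_imp_le[of "int q" "\<bar>?L (a * b) - ?L a * ?L b\<bar>"] by fastforce
qed

lemma Legendre_cong:
  assumes "[a = b] (mod q)"
  shows "Legendre a q = Legendre b q"
proof -
  have "[a = 0] (mod q) \<longleftrightarrow> [b = 0] (mod q)"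
    using assms cong_sym cong_trans by blast
  moreover have "QuadRes q a \<longleftrightarrow> QuadRes q b"
    unfolding QuadRes_def using assms cong_sym cong_trans by blast
  ultimately show ?thesis by (simp add: Legendre_def)
qed

lemma prime_factor_of_odd:
  assumes "odd m" "q \<in># prime_factorization m"
  shows "prime q" "2 < (q::nat)" "odd q"
proof -
  show q: "prime q" using assms by auto
  have "q dvd m" using assms by auto
  then show "odd q" using assms(1) dvd_trans by blast
  then show "2 < q" using prime_ge_2_nat[OF q] by (cases "q = 2") auto
qed

lemma jacobi_mult:
  assumes "odd m"
  shows "jacobi (a * b) m = jacobi a m * jacobi b m"
proof -
  have "jacobi (a * b) m
      = (\<Prod>q\<in>#prime_factorization m. Legendre a (int q) * Legendre b (int q))"
    unfolding jacobi_def using prime_factor_of_odd[OF assms] Legendre_mult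
    by (intro arg_cong[where f = prod_mset] image_mset_cong) auto
  then show ?thesis by (simp add: jacobi_def prod_mset.distrib)
qed

lemma jacobi_cong:
  assumes "[a = b] (mod int m)"
  shows "jacobi a m = jacobi b m"
  unfolding jacobi_def
proof (intro arg_cong[where f = prod_mset] image_mset_cong)
  fix q assume "q \<in># prime_factorization m"
  then have "int q dvd int m" by auto
  then show "Legendre a (int q) = Legendre b (int q)"
    using assms cong_dvd_modulus Legendre_cong by blast
qed

lemma jacobi_1 [simp]: assumes "odd m" shows "jacobi 1 m = 1"
proof -
  have "Legendre 1 (int q) = 1" if "q \<in># prime_factorization m" for q
  proof -
    have "\<not> [1 = 0] (mod int q)"
      using prime_factor_of_odd[OF assms that] by (auto simp: Cong.cong_def)
    moreover have "QuadRes (int q) 1" unfolding QuadRes_def by (rule exI[of _ 1]) simp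
    ultimately show ?thesis by (simp add: Legendre_def)
  qed
  then have "jacobi 1 m = (\<Prod>q\<in>#prime_factorization m. 1)"
    unfolding jacobi_def by (intro arg_cong[where f = prod_mset] image_mset_cong) auto
  then show ?thesis by simp
qed

lemma fermat_number_pos [simp]: "0 < fermat_number n"
  and odd_fermat_number [simp]: "odd (fermat_number n)"
  by (auto simp: fermat_number_def)

lemma jacobi_prod_mset:
  assumes "odd m"
  shows "jacobi (int (prod_mset M)) m = (\<Prod>p\<in>#M. jacobi (int p) m)"
  using assms by (induction M) (auto simp: jacobi_mult)

section \<open>Reciprocity for a prime over a modulus 1 modulo 4\<close>

text \<open>Quadratic reciprocity solved for one symbol, with the sign read off modulo 4. The case
  \<open>p = q\<close>, where both symbols vanish, is included because \<open>p\<close> may divide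
  the modulus later on.\<close>

lemma Legendre_swap:
  assumes "prime p" "2 < p" "prime q" "2 < q"
  shows "Legendre (int p) (int q)
    = (if p mod 4 = 1 \<or> q mod 4 = 1 then 1 else -1) * Legendre (int q) (int p)"
proof (cases "p = q")
  case True
  then show ?thesis by (simp add: Legendre_def Cong.cong_def)
next
  case False
  have od: "odd p" "odd q" using assms prime_odd_nat by auto
  have ev: "even ((r - 1) div 2) \<longleftrightarrow> r mod 4 = 1" if "odd r" for r :: nat
    using that by presburger
  have "Legendre (int p) (int q) * Legendre (int q) (int p)
      = (-1) ^ ((p - 1) div 2 * ((q - 1) div 2))"
    by (intro Quadratic_Reciprocity) (use assms False in auto)
  also have "\<dots> = (if p mod 4 = 1 \<or> q mod 4 = 1 then 1 else -1)"
    using ev od by (auto simp: minus_one_power_iff)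
  finally have e: "Legendre (int p) (int q) * Legendre (int q) (int p)
      = (if p mod 4 = 1 \<or> q mod 4 = 1 then 1 else -1)" .
  have "Legendre a b = -1 \<or> Legendre a b = 0 \<or> Legendre a b = 1" for a b
    by (simp add: Legendre_def)
  note this[of "int p" "int q"] this[of "int q" "int p"]
  then show ?thesis using e by (elim disjE) (auto simp only: split: if_splits)
qed

text \<open>The sign depends on the residues modulo 4 only, and the character modulo 4 is
  multiplicative, so that primes of the modulus that are \<open>3\<close> modulo \<open>4\<close> contribute in pairs.\<close>

lemma jacobi_reciprocity:
  assumes "prime p" "2 < p" "odd m" "m mod 4 = 1"
  shows "jacobi (int p) m = Legendre (int m) (int p)"
proof -
  \<comment> \<open>The induction runs over arbitrary multisets of odd primes and carries the sign
    along, since partial products of the prime factors of \<open>m\<close> may be 3 modulo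
    4.\<close>
  have "(\<Prod>q\<in>#M. Legendre (int p) (int q))
      = (if p mod 4 = 1 \<or> prod_mset M mod 4 = 1 then 1 else -1) * Legendre (int (prod_mset M)) (int p)
      \<and> odd (prod_mset M)"
    if "\<forall>q\<in>#M. prime q \<and> 2 < q" for M
    using that
  proof (induction M)
    case empty
    have "\<not> [1 = 0] (mod int p)" using assms by (auto simp: Cong.cong_def)
    moreover have "QuadRes (int p) 1" unfolding QuadRes_def by (rule exI[of _ 1]) simp
    ultimately show ?case by (simp add: Legendre_def)
  next
    case (add q M)
    let ?P = "prod_mset M"
    have q: "prime q" "2 < q" "odd q" using add prime_odd_nat by auto
    have IH: "(\<Prod>q\<in>#M. Legendre (int p) (int q))
      = (if p mod 4 = 1 \<or> ?P mod 4 = 1 then 1 else -1) * Legendre (int ?P) (int p)" "odd ?P"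
      using add by auto
    have m4: "q mod 4 = 1 \<or> q mod 4 = 3" "?P mod 4 = 1 \<or> ?P mod 4 = 3"
      using q(3) IH(2) by presburger+
    have mm: "q * ?P mod 4 = (q mod 4) * (?P mod 4) mod 4" by (simp add: mod_mult_eq)
    have "q * ?P mod 4 = 1 \<longleftrightarrow> (q mod 4 = 1 \<longleftrightarrow> ?P mod 4 = 1)"
      using m4 unfolding mm by (elim disjE; simp)
    moreover have "Legendre (int (q * ?P)) (int p) = Legendre (int q) (int p) * Legendre (int ?P) (int p)"
      using Legendre_mult[OF assms(1,2), of "int q" "int ?P"] by simp
    moreover have "(\<Prod>q\<in>#add_mset q M. Legendre (int p) (int q))
        = ((if p mod 4 = 1 \<or> q mod 4 = 1 then 1 else -1) * Legendre (int q) (int p))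
        * ((if p mod 4 = 1 \<or> ?P mod 4 = 1 then 1 else -1) * Legendre (int ?P) (int p))"
      by (simp only: image_mset_add_mset prod_mset.add_mset IH(1) Legendre_swap[OF assms(1,2) q(1,2)])
    ultimately show ?case using IH(2) q(3) by simp
  qed
  note key = this[of "prime_factorization m"]
  have "\<forall>q\<in>#prime_factorization m. prime q \<and> 2 < q" using prime_factor_of_odd[OF assms(3)] by auto
  moreover have "prod_mset (prime_factorization m) = m"
    using assms(3) by (intro prod_mset_prime_factorization_nat) (auto intro: odd_pos)
  ultimately show ?thesis using key assms(4) by (simp add: jacobi_def)
qed

section \<open>The symbols of 2 and 3 modulo Fermat numbers\<close>

lemma fermat_number_mod_4: "n \<ge> 1 \<Longrightarrow> fermat_number n mod 4 = 1"
proof -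
  assume "n \<ge> 1"
  then have "(2::nat) ^ 1 \<le> 2 ^ n" by (intro power_increasing) auto
  then have "(2::nat) ^ 2 dvd 2 ^ 2 ^ n" by (intro le_imp_power_dvd) simp
  then show ?thesis unfolding fermat_number_def by (simp add: mod_Suc)
qed

text \<open>For \<open>n \<ge> 1\<close> the exponent \<open>2 ^ n\<close> is even, so the Fermat
  number is 2 modulo 3, a non-residue. The number 3 later serves as the multiplier that exchanges
  residues of symbol 1 and -1.\<close>

lemma jacobi_3_fermat_number:
  assumes "n \<ge> 1"
  shows "jacobi 3 (fermat_number n) = -1"
proof -
  have "jacobi (int 3) (fermat_number n) = Legendre (int (fermat_number n)) (int 3)"
    by (rule jacobi_reciprocity) (use fermat_number_mod_4[OF assms] in auto)
  also have "\<dots> = Legendre 2 3"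
  proof -
    have e: "even ((2::nat) ^ n)" using assms by simp
    then obtain j where j: "(2::nat) ^ n = 2 * j" by blast
    have "[(4::int) ^ j = 1 ^ j] (mod 3)" by (intro cong_pow) (simp add: Cong.cong_def)
    then have "[4 ^ j + 1 = 1 + (1::int)] (mod 3)" by (intro cong_add) auto
    then have "[int (fermat_number n) = 2] (mod 3)"
      by (simp add: fermat_number_def j power_mult add.commute)
    then show ?thesis using Legendre_cong by auto
  qed
  also have "\<dots> = -1"
  proof -
    have "\<not> QuadRes 3 2"
    proof
      assume "QuadRes 3 2"
      then obtain y :: int where y: "y^2 mod 3 = 2 mod 3" by (auto simp: QuadRes_def Cong.cong_def)
      have m: "y^2 mod 3 = (y mod 3)^2 mod 3" by (simp add: power_mod)
      have "y mod 3 = 0 \<or> y mod 3 = 1 \<or> y mod 3 = 2" by presburger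
      then show False using y unfolding m by auto
    qed
    then show ?thesis by (auto simp: Legendre_def Cong.cong_def)
  qed
  finally show ?thesis by simp
qed

text \<open>With \<open>t = 2 ^ 2 ^ (n - 2)\<close>, so that \<open>t\<^sup>4 = -1\<close>, a square root of \<open>2\<close> is \<open>t - t\<^sup>3\<close>.\<close>

lemma jacobi_2_fermat_number:
  assumes "n \<ge> 2"
  shows "jacobi 2 (fermat_number n) = 1"
proof -
  define t :: int where "t = 2 ^ 2 ^ (n - 2)"
  have "(2::nat) ^ n = 2 ^ (n - 2) * 2 ^ 2" using assms by (metis le_add_diff_inverse2 power_add)
  then have t4: "int (fermat_number n) = t ^ 4 + 1"
    by (simp add: fermat_number_def t_def flip: power_mult)
  have "Legendre 2 (int q) = 1" if q: "q \<in># prime_factorization (fermat_number n)" for q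
  proof -
    have d: "int q dvd t ^ 4 + 1" using q t4
      by (metis in_prime_factors_iff of_nat_dvd_iff)
    have "(t - t^3)^2 - 2 = (t ^ 4 + 1) * (t^2 - 2)"
      by (simp add: algebra_simps power2_eq_square eval_nat_numeral)
    then have "[(t - t^3)^2 = 2] (mod int q)" using d by (auto simp: cong_iff_dvd_diff)
    moreover have "\<not> [2 = 0] (mod int q)"
      using prime_factor_of_odd[OF odd_fermat_number q] by (auto simp: Cong.cong_def)
    ultimately show ?thesis unfolding Legendre_def QuadRes_def by auto
  qed
  then have "jacobi 2 (fermat_number n) = (\<Prod>q\<in>#prime_factorization (fermat_number n). 1)"
    unfolding jacobi_def by (intro arg_cong[where f = prod_mset] image_mset_cong) auto
  then show ?thesis by simp
qed

section \<open>Periodicity of the symbols in n\<close>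

text \<open>Let \<open>p - 1 = 2 ^ j * d\<close> with \<open>d\<close> odd. For
  \<open>n \<ge> k\<close> the power \<open>2 ^ j\<close> divides \<open>2 ^ n\<close>, and modulo
  \<open>d\<close> Euler's theorem gives \<open>2 ^ n\<close> the period \<open>totient d\<close>.
  So \<open>2 ^ n\<close> repeats modulo \<open>p - 1\<close>, and Fermat's little theorem carries
  this to the outer power. \<open>T\<close> is a multiple of every positive number up to
  \<open>p\<close>, so that one factorial can serve all primes dividing \<open>A\<close>.\<close>

lemma fermat_number_periodic_mod_prime:
  assumes p: "prime p" "2 < p" and k: "\<not> 2 ^ Suc k dvd p - 1"
    and T: "\<And>t. 0 < t \<Longrightarrow> t \<le> p \<Longrightarrow> t dvd T" and "n \<ge> k"
  shows "[fermat_number (n + T) = fermat_number n] (mod p)"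
proof -
  have p1: "p - 1 \<noteq> 0" using p by auto
  have "\<not> is_unit (2 :: nat)" by simp
  then obtain j d where d: "p - 1 = 2 ^ j * d" "\<not> 2 dvd d"
    using multiplicity_decompose'[of "p - 1" 2] p1 by blast
  have jk: "j \<le> k"
  proof (rule ccontr)
    assume "\<not> j \<le> k"
    then have "2 ^ Suc k dvd (2::nat) ^ j" by (intro le_imp_power_dvd) auto
    then show False using k d(1) by (metis dvd_mult2)
  qed
  have d0: "d > 0" using d(2) by (cases d) auto
  have "d dvd p - 1" unfolding d(1) by simp
  then have "d \<le> p - 1" using p1 by (intro dvd_imp_le) auto
  then have "totient d \<le> p" using totient_le[of d] by linarith
  moreover have "totient d > 0" using d0 by simp
  ultimately have "totient d dvd T" using T by blast
  then obtain s where s: "T = totient d * s" by blast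
  have "coprime 2 d" using d(2) by simp
  then have "[2 ^ totient d = 1] (mod d)" by (rule euler_theorem)
  then have "[(2 ^ totient d) ^ s = 1 ^ s] (mod d)" by (rule cong_pow)
  then have "[2 ^ T = 1] (mod d)" by (simp add: s power_mult)
  \<comment> \<open>Scaling the congruence together with its modulus by \<open>2 ^ n\<close> brings
    in the power of 2 in \<open>p - 1\<close>.\<close>
  then have "[2 ^ n * 2 ^ T = 2 ^ n * 1] (mod 2 ^ n * d)"
    by (simp add: Cong.cong_def mod_mult_mult1 del: mult_1_right)
  then have "[2 ^ (n + T) = 2 ^ n] (mod 2 ^ n * d)" by (simp add: power_add)
  moreover have "p - 1 dvd 2 ^ n * d"
    unfolding d(1) by (intro mult_dvd_mono le_imp_power_dvd) (use jk \<open>n \<ge> k\<close> in auto)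
  ultimately have c: "[2 ^ (n + T) = 2 ^ n] (mod p - 1)" by (rule cong_dvd_modulus_nat)
  have "(2::nat) ^ n \<le> 2 ^ (n + T)" by simp
  then obtain r where r: "2 ^ (n + T) = 2 ^ n + r * (p - 1)"
    using c cong_le_nat[of "2 ^ n" "2 ^ (n + T)" "p - 1"] by (auto simp: cong_sym_eq ac_simps)
  have "\<not> p dvd 2" using p by (auto dest: dvd_imp_le)
  then have "[2 ^ (p - 1) = 1] (mod p)" using fermat_theorem p(1) by blast
  then have "[(2 ^ (p - 1)) ^ r = 1 ^ r] (mod p)" by (rule cong_pow)
  then have "[2 ^ 2 ^ n * (2 ^ (p - 1)) ^ r = 2 ^ 2 ^ n * 1] (mod p)"
    by (intro cong_mult) auto
  then have "[2 ^ 2 ^ (n + T) = 2 ^ 2 ^ n] (mod p)"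
    unfolding r mult.commute[of r] by (simp add: power_add power_mult)
  then show ?thesis unfolding fermat_number_def by (intro cong_add) auto
qed

text \<open>The symbol splits over the primes dividing \<open>A\<close>. For 2 it is constantly 1
  from \<open>n = 2\<close> on, hence \<open>k \<ge> 2\<close>; for odd primes reciprocity turns it
  into a Legendre symbol of a periodic sequence.\<close>

lemma jacobi_fermat_number_periodic:
  assumes "A > 0" "k \<ge> 2"
    and k: "\<And>p. prime p \<Longrightarrow> p dvd A \<Longrightarrow> 2 < p \<Longrightarrow> \<not> 2 ^ Suc k dvd p - 1"
    and "n \<ge> k"
  shows "jacobi (int A) (fermat_number (n + fact A)) = jacobi (int A) (fermat_number n)"
proof -
  have pf: "jacobi (int p) (fermat_number (n + fact A)) = jacobi (int p) (fermat_number n)"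
    if "p \<in># prime_factorization A" for p
  proof (cases "p = 2")
    case True
    then show ?thesis using jacobi_2_fermat_number assms by simp
  next
    case False
    have p: "prime p" "p dvd A" "2 < p"
      using that False prime_ge_2_nat[of p] by (auto simp: in_prime_factors_iff)
    have "p \<le> A" using p(2) assms(1) by (rule dvd_imp_le)
    then have "[fermat_number (n + fact A) = fermat_number n] (mod p)"
      by (intro fermat_number_periodic_mod_prime[OF p(1,3) k[OF p]] dvd_fact) (use assms in auto)
    then have "[int (fermat_number (n + fact A)) = int (fermat_number n)] (mod int p)"
      by (simp add: cong_int_iff)
    then show ?thesis
      using jacobi_reciprocity[OF p(1,3)] fermat_number_mod_4 Legendre_cong assms by simp
  qed
  have A: "A = prod_mset (prime_factorization A)"
    using assms(1) prod_mset_prime_factorization_nat by simp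
  have J: "jacobi (int A) m = (\<Prod>p\<in>#prime_factorization A. jacobi (int p) m)" if "odd m" for m
    using jacobi_prod_mset[OF that, of "prime_factorization A"] A by simp
  show ?thesis
    unfolding J[OF odd_fermat_number] using pf
    by (intro arg_cong[where f = prod_mset] image_mset_cong)
qed

text \<open>Shifting \<open>n\<close> by multiples of the period \<open>fact A\<close> reaches the
  range where the symbol is known to be 1. The unspecified threshold in \<open>anti_elite\<close>
  thus becomes explicit.\<close>

lemma anti_elite_jacobi:
  assumes "anti_elite A" "k \<ge> 2"
    and k: "\<And>p. prime p \<Longrightarrow> p dvd A \<Longrightarrow> 2 < p \<Longrightarrow> \<not> 2 ^ Suc k dvd p - 1"
    and "n \<ge> k"
  shows "jacobi (int A) (fermat_number n) = 1"
proof -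
  have "A > 0" using assms by (simp add: anti_elite_def)
  obtain n0 where n0: "\<And>n. n \<ge> n0 \<Longrightarrow> jacobi (int A) (fermat_number n) = 1"
    using assms(1) by (auto simp: anti_elite_def eventually_sequentially)
  have per: "jacobi (int A) (fermat_number (n + s * fact A)) = jacobi (int A) (fermat_number n)" for s
  proof (induction s)
    case (Suc s)
    have "jacobi (int A) (fermat_number ((n + s * fact A) + fact A))
        = jacobi (int A) (fermat_number (n + s * fact A))"
      by (rule jacobi_fermat_number_periodic[OF \<open>A > 0\<close> assms(2) k]) (use \<open>n \<ge> k\<close> in auto)
    then show ?case using Suc by (simp add: algebra_simps)
  qed simp
  have "n0 * 1 \<le> n0 * fact A" by (intro mult_left_mono) auto
  then have "n + n0 * fact A \<ge> n0" by linarith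
  then show ?thesis using n0 per by metis
qed

section \<open>Chebyshev's bound for primes 1 modulo 2^k\<close>

text \<open>Rests on \<open>fact (2 * n) = 2 ^ n * fact n * D\<close> with \<open>D\<close> the
  product of the odd numbers below \<open>2 * n\<close>. The Chebyshev argument divides by the odd
  part of \<open>fact N\<close> only, and the bound on \<open>e\<close> keeps the loss at a factor
  of at most \<open>2 ^ N\<close>.\<close>

lemma odd_part_fact_power_2: "\<exists>e M. e \<le> 2 ^ a \<and> odd M \<and> (fact (2 ^ a) :: nat) = 2 ^ e * M"
proof -
  have double: "\<exists>D. odd D \<and> (fact (2 * n) :: nat) = 2 ^ n * fact n * D" for n
  proof (induction n)
    case 0
    show ?case by (intro exI[of _ 1]) simp
  next
    case (Suc n)
    then obtain D :: nat where D: "odd D" "fact (2 * n) = 2 ^ n * fact n * D" by blast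
    have "(fact (2 * Suc n) :: nat) = (2 * n + 2) * ((2 * n + 1) * fact (2 * n))"
      by (simp add: algebra_simps)
    also have "\<dots> = 2 ^ Suc n * fact (Suc n) * ((2 * n + 1) * D)"
      unfolding D(2) by (simp add: algebra_simps)
    finally show ?case using D(1) by (intro exI[of _ "(2 * n + 1) * D"]) auto
  qed
  show ?thesis
  proof (induction a)
    case 0
    show ?case by (intro exI[of _ 0] exI[of _ 1]) simp
  next
    case (Suc a)
    then obtain e M where e: "e \<le> 2 ^ a" "odd M" "(fact (2 ^ a) :: nat) = 2 ^ e * M" by blast
    obtain D :: nat where D: "odd D" "fact (2 * 2 ^ a) = 2 ^ 2 ^ a * fact (2 ^ a) * D"
      using double by blast
    have "fact (2 ^ Suc a) = 2 ^ (2 ^ a + e) * (M * D)"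
      unfolding power_Suc D(2) e(3) by (simp add: power_add algebra_simps)
    moreover have "odd (M * D)" using e D by simp
    moreover have "2 ^ a + e \<le> 2 ^ Suc a" using e by simp
    ultimately show ?case by blast
  qed
qed

text \<open>Multiplying by the \<open>N\<close>-th power of an inverse of \<open>q\<close> modulo \<open>M\<close> turns the
  product into a product of \<open>N\<close> consecutive integers.\<close>

lemma divisor_of_fact_dvd_prod_progression:
  fixes q M N :: nat
  assumes M: "M dvd fact N" and "coprime q M"
  shows "M dvd (\<Prod>j=1..N. q * j + 1)"
proof -
  obtain u where u: "[q * u = 1] (mod M)" using assms(2) cong_solve_coprime_nat by auto
  have "coprime u M"
    using u by (metis coprime_mult_left_iff coprime_1_left cong_imp_coprime cong_sym)
  have "[(\<Prod>j=1..N. u * (q * j + 1)) = (\<Prod>j=1..N. u + j)] (mod M)"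
  proof (rule cong_prod)
    fix j
    have "[q * u * j + u = 1 * j + u] (mod M)" by (intro cong_add cong_mult u) auto
    then show "[u * (q * j + 1) = u + j] (mod M)" by (simp add: algebra_simps)
  qed
  moreover have "(\<Prod>j=1..N. u * (q * j + 1)) = u ^ N * (\<Prod>j=1..N. q * j + 1)"
    by (simp only: prod.distrib prod_constant card_atLeastAtMost diff_Suc_1)
  moreover have "M dvd (\<Prod>j=1..N. u + j)"
  proof -
    \<comment> \<open>The product of \<open>N\<close> consecutive integers is \<open>fact N\<close>
      times a binomial coefficient.\<close>
    have "(\<Prod>j=1..N. u + j) * fact u = fact (u + N)"
    proof (induction N)
      case (Suc N)
      then show ?case by (simp add: algebra_simps)
    qed simp
    then have "(\<Prod>j=1..N. u + j) * fact u = (u + N choose u) * fact N * fact u"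
      using binomial_fact_lemma[of u "u + N"] by (simp add: algebra_simps)
    then have "(\<Prod>j=1..N. u + j) = (u + N choose u) * fact N" by simp
    then show ?thesis using M by simp
  qed
  ultimately have "M dvd u ^ N * (\<Prod>j=1..N. q * j + 1)"
    using cong_dvd_iff by metis
  then show ?thesis
    using \<open>coprime u M\<close> by (metis coprime_commute coprime_dvd_mult_right_iff coprime_power_right_iff)
qed

lemma prod_primes_dvd:
  fixes P :: nat
  assumes "finite S" "\<And>p. p \<in> S \<Longrightarrow> prime p" "\<And>p. p \<in> S \<Longrightarrow> p dvd P"
  shows "\<Prod>S dvd P"
  using assms
proof (induction S rule: finite_induct)
  case (insert p S)
  have "coprime p (\<Prod>S)"
    using insert by (intro prod_coprime_right primes_coprime) auto
  then show ?case using insert by (auto intro: divides_mult)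
qed simp

text \<open>Chebyshev's argument in the progression \<open>1\<close> modulo \<open>2 ^ k\<close>, with
  \<open>(\<Prod>j\<le>N. 2 ^ k * j + 1) / N!\<close> in the place of the central binomial coefficient.\<close>

lemma card_primes_progression_dyadic:
  assumes "1 \<le> k" "k \<le> i"
  shows "i * card {p::nat. prime p \<and> 2 ^ k dvd p - 1 \<and> 2 ^ i \<le> p \<and> p < 2 ^ Suc i}
    \<le> (k + 2) * 2 ^ (Suc i - k)"
proof -
  define q :: nat where "q = 2 ^ k"
  \<comment> \<open>Chosen so that \<open>q * N = 2 ^ Suc i\<close>: every prime of \<open>S\<close>
    is then one of the factors \<open>q * j + 1\<close> of \<open>P\<close>.\<close>
  define N :: nat where "N = 2 ^ (Suc i - k)"
  define S where "S = {p::nat. prime p \<and> 2 ^ k dvd p - 1 \<and> 2 ^ i \<le> p \<and> p < 2 ^ Suc i}"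
  define P where "P = (\<Prod>j=1..N. q * j + 1)"
  have finS: "finite S" by (rule finite_subset[of _ "{..<2 ^ Suc i}"]) (auto simp: S_def)
  have qN: "q * N = 2 ^ Suc i" using assms by (simp add: q_def N_def flip: power_add)
  obtain e M where e: "e \<le> N" "odd M" "(fact N :: nat) = 2 ^ e * M"
    using odd_part_fact_power_2[of "Suc i - k"] unfolding N_def by blast
  have "coprime q M" using e(2) by (simp add: q_def)
  have MP: "M dvd P" unfolding P_def
    by (rule divisor_of_fact_dvd_prod_progression) (use e \<open>coprime q M\<close> in auto)
  \<comment> \<open>Strictness matters for \<open>k = 1\<close>, where \<open>N = 2 ^ i\<close>: it
    keeps \<open>p\<close> from dividing \<open>fact N\<close>.\<close>
  have odd_S: "odd p" "2 ^ i < p" if "p \<in> S" for p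
  proof -
    have "2 dvd (2::nat) ^ k" using assms by simp
    moreover have "2 ^ k dvd p - 1" using that by (simp add: S_def)
    ultimately have "2 dvd p - 1" by (rule dvd_trans)
    moreover have "p > 1" using that prime_gt_1_nat by (auto simp: S_def)
    ultimately show "odd p" by (cases p) auto
    moreover have "even ((2::nat) ^ i)" using assms by simp
    ultimately show "2 ^ i < p" using that by (cases "2 ^ i = p") (auto simp: S_def)
  qed
  have p_dvd: "p dvd P" if "p \<in> S" for p
  proof -
    obtain j where j: "p - 1 = q * j" using \<open>p \<in> S\<close> by (auto simp: S_def q_def)
    have p: "p > 1" "p < q * N" using \<open>p \<in> S\<close> prime_gt_1_nat qN by (auto simp: S_def)
    have "q * j < q * N" unfolding j[symmetric] using p by linarith
    moreover have "j \<noteq> 0" using j p by (intro notI) simp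
    ultimately have "j \<in> {1..N}" by auto
    moreover have "p = q * j + 1" using j p by simp
    ultimately show ?thesis unfolding P_def
      using dvd_prodI[of "{1..N}" j "\<lambda>j. q * j + 1"] by simp
  qed
  have "coprime p M" if "p \<in> S" for p
  proof -
    have "N \<le> 2 ^ i" unfolding N_def using assms by (intro power_increasing) auto
    then have "\<not> p dvd fact N"
      using odd_S(2)[OF that] that prime_dvd_fact_iff[of p N] by (auto simp: S_def)
    then show ?thesis using that e(3) by (intro prime_imp_coprime) (auto simp: S_def)
  qed
  \<comment> \<open>The primes of \<open>S\<close> and the odd part \<open>M\<close> divide
    \<open>P\<close> independently, so their product is at most \<open>P\<close>. Afterwards
    \<open>M\<close> cancels against \<open>fact N = 2 ^ e * M\<close>.\<close>
  then have "coprime (\<Prod>S) M" by (intro prod_coprime_left) simp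
  moreover have "\<Prod>S dvd P"
    using finS p_dvd by (intro prod_primes_dvd) (auto simp: S_def)
  ultimately have "\<Prod>S * M dvd P" using MP by (rule_tac divides_mult) auto
  moreover have "P > 0" unfolding P_def by (intro prod_pos) simp
  ultimately have "\<Prod>S * M \<le> P" by (rule dvd_imp_le)
  moreover have "(\<Prod>p\<in>S. 2 ^ i) \<le> \<Prod>S" by (intro prod_mono) (auto simp: S_def)
  moreover have "P \<le> (2 ^ Suc k) ^ N * fact N"
  proof -
    have "P \<le> (\<Prod>j=1..N. 2 ^ Suc k * j)" unfolding P_def
    proof (intro prod_mono)
      fix j assume "j \<in> {1..N}"
      then have "1 \<le> q * j" by (simp add: q_def)
      then show "0 \<le> q * j + 1 \<and> q * j + 1 \<le> 2 ^ Suc k * j" by (simp add: q_def)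
    qed
    then show ?thesis by (simp add: prod.distrib fact_prod)
  qed
  ultimately have "(2 ^ i) ^ card S * M \<le> (2 ^ Suc k) ^ N * fact N"
    unfolding prod_constant using mult_le_mono1[of "(2 ^ i) ^ card S" "\<Prod>S" M] by linarith
  also have "\<dots> = (2 ^ Suc k) ^ N * (2 ^ e * M)" by (simp only: e(3))
  also have "\<dots> = 2 ^ (Suc k * N + e) * M" by (simp add: power_add power_mult)
  finally have "(2 ^ i) ^ card S \<le> (2::nat) ^ (Suc k * N + e)" using e(2) odd_pos[of M] by simp
  then have "(2::nat) ^ (i * card S) \<le> 2 ^ (Suc k * N + e)" by (simp add: power_mult)
  then have "i * card S \<le> Suc k * N + e" by (rule power_le_imp_le_exp[rotated]) simp
  also have "\<dots> \<le> (k + 2) * N" using e(1) by simp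
  finally show ?thesis unfolding S_def N_def .
qed

section \<open>Integers with prescribed symbols modulo Fermat numbers\<close>

lemma jacobi_mod:
  assumes "d dvd P"
  shows "jacobi (int (m mod P)) d = jacobi (int m) d"
proof (rule jacobi_cong)
  have "[m mod P = m] (mod d)" using assms by (simp add: Cong.cong_def mod_mod_cancel)
  then show "[int (m mod P) = int m] (mod int d)" by (simp only: cong_int_iff)
qed

text \<open>Multiplication by 3 maps the residues counted injectively to those with value -1, a
  disjoint class. The factor \<open>c\<close> will be the symbol of a prime \<open>p\<close>, which
  prescribes the symbol of its cofactor.\<close>

lemma two_card_jacobi_fermat_number_le:
  assumes "n \<ge> 1"
  shows "2 * card {r. r < fermat_number n \<and> jacobi (int r) (fermat_number n) * c = 1}
    \<le> fermat_number n"
proof -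
  define F where "F = fermat_number n"
  define S where "S s = {r. r < F \<and> jacobi (int r) F * c = s}" for s
  have F: "odd F" "F > 0" by (simp_all add: F_def)
  have fin: "finite (S s)" for s by (simp add: S_def)
  \<comment> \<open>If 3 divided \<open>F\<close>, the symbol of 3 would be 0 instead of -1.
    Coprimality makes multiplication by 3 injective modulo \<open>F\<close>.\<close>
  have "F mod 3 \<noteq> 0"
  proof
    assume "F mod 3 = 0"
    then have "[int 3 = 0] (mod int 3) \<and> 3 dvd F" by (auto simp: Cong.cong_def)
    moreover have "prime (3::nat)" by simp
    ultimately have "3 \<in># prime_factorization F" using F by (simp add: in_prime_factors_iff)
    then have "jacobi 3 F = 0" unfolding jacobi_def
      by (auto simp: Legendre_def Cong.cong_def intro!: rev_image_eqI[of 3])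
    then show False using jacobi_3_fermat_number[OF assms] by (simp add: F_def)
  qed
  then have "coprime 3 F" by (intro prime_imp_coprime) auto
  have "inj_on (\<lambda>r. 3 * r mod F) (S 1)"
  proof (rule inj_onI)
    fix r s assume rs: "r \<in> S 1" "s \<in> S 1" "3 * r mod F = 3 * s mod F"
    then have "[r = s] (mod F)"
      using cong_mult_lcancel_nat \<open>coprime 3 F\<close> by (auto simp: Cong.cong_def coprime_commute)
    then show "r = s" using rs by (simp add: S_def cong_less_modulus_unique_nat)
  qed
  moreover have "(\<lambda>r. 3 * r mod F) ` S 1 \<subseteq> S (-1)"
  proof clarify
    fix r assume r: "r \<in> S 1"
    have "jacobi (int (3 * r mod F)) F = jacobi (3 * int r) F"
      by (intro jacobi_cong) (simp add: Cong.cong_def of_nat_mod)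
    also have "\<dots> = - jacobi (int r) F"
      using jacobi_3_fermat_number[OF assms] jacobi_mult[OF F(1)] by (simp add: F_def)
    finally show "3 * r mod F \<in> S (-1)" using r F by (simp add: S_def)
  qed
  ultimately have "card (S 1) \<le> card (S (-1))" using fin card_inj_on_le by blast
  moreover have "card (S 1) + card (S (-1)) = card (S 1 \<union> S (-1))"
    using fin by (intro card_Un_disjoint[symmetric]) (auto simp: S_def)
  moreover have "card (S 1 \<union> S (-1)) \<le> card {..<F}" by (intro card_mono) (auto simp: S_def)
  ultimately show ?thesis by (simp add: S_def F_def)
qed

lemma prod_fermat_number: "(\<Prod>n<K. fermat_number n) + 1 = 2 ^ 2 ^ K"
proof (induction K)
  case (Suc K)
  define P where "P = (\<Prod>n<K. fermat_number n)"
  have P: "2 ^ 2 ^ K = P + 1" using Suc by (simp add: P_def)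
  have F: "fermat_number K = P + 1 + 1" by (simp only: fermat_number_def P)
  have "(\<Prod>n<Suc K. fermat_number n) + 1 = P * (P + 1 + 1) + 1"
    using F by (simp add: P_def)
  also have "\<dots> = (P + 1) * (P + 1)" by (simp add: algebra_simps)
  also have "\<dots> = 2 ^ 2 ^ Suc K" unfolding P[symmetric] by (simp flip: power_add)
  finally show ?case .
qed simp

text \<open>The product divides that of all earlier Fermat numbers, which is odd and equals
  \<open>fermat_number K - 2\<close>.\<close>

lemma prod_fermat_number_interval:
  assumes "k \<le> K"
  shows "coprime (\<Prod>n=k..<K. fermat_number n) (fermat_number K)"
    and "(\<Prod>n=k..<K. fermat_number n) \<le> 2 ^ 2 ^ K"
proof -
  define P where "P = (\<Prod>n=k..<K. fermat_number n)"
  define Q where "Q = (\<Prod>n<K. fermat_number n)"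
  have Q: "fermat_number K = Q + 2" using prod_fermat_number[of K] by (simp add: fermat_number_def Q_def)
  have "even (Q + 1)" unfolding Q_def prod_fermat_number by simp
  then have "odd Q" by simp
  then have "coprime Q 2" by simp
  then have "coprime Q (fermat_number K)"
    unfolding Q by (metis coprime_iff_gcd_eq_1 gcd_add2)
  moreover have "P dvd Q" unfolding P_def Q_def by (intro prod_dvd_prod_subset) auto
  ultimately show "coprime P (fermat_number K)" by (meson coprime_divisors dvd_refl)
  have "Q > 0" unfolding Q_def by (intro prod_pos) simp
  then have "P \<le> Q" using \<open>P dvd Q\<close> by (rule_tac dvd_imp_le)
  then show "P \<le> 2 ^ 2 ^ K" using prod_fermat_number[of K] by (simp add: Q_def)
qed

text \<open>Induction on \<open>K\<close> by the Chinese remainder theorem: each new Fermat number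
  is coprime to the product so far, and its condition leaves at most half of its residues.\<close>

lemma card_jacobi_block_le:
  assumes "1 \<le> k" "k \<le> K"
  shows "2 ^ (K - k) * card {m. m < (\<Prod>n=k..<K. fermat_number n)
      \<and> (\<forall>n\<in>{k..<K}. jacobi (int m) (fermat_number n) * c n = 1)}
    \<le> (\<Prod>n=k..<K. fermat_number n)"
  using assms(2)
proof (induction K rule: dec_induct)
  case base
  have "card {m::nat. m < 1} \<le> 1" by simp
  then show ?case by simp
next
  case (step K)
  define P where "P = (\<Prod>n=k..<K. fermat_number n)"
  define F where "F = fermat_number K"
  define G where "G = {m. m < P \<and> (\<forall>n\<in>{k..<K}. jacobi (int m) (fermat_number n) * c n = 1)}"
  define H where "H = {m. m < P * F \<and> (\<forall>n\<in>{k..<Suc K}. jacobi (int m) (fermat_number n) * c n = 1)}"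
  define R where "R = {r. r < F \<and> jacobi (int r) F * c K = 1}"
  have P0: "P > 0" unfolding P_def by (intro prod_pos) simp
  have cop: "coprime P F" unfolding P_def F_def by (rule prod_fermat_number_interval) (rule step)
  have "inj_on (\<lambda>m. (m mod P, m mod F)) H"
  proof (rule inj_onI)
    fix a b assume ab: "a \<in> H" "b \<in> H" "(a mod P, a mod F) = (b mod P, b mod F)"
    then have "[a = b] (mod P * F)" using cop by (intro coprime_cong_mult_nat) (auto simp: Cong.cong_def)
    then show "a = b" using ab by (simp add: H_def cong_less_modulus_unique_nat)
  qed
  moreover have "(\<lambda>m. (m mod P, m mod F)) ` H \<subseteq> G \<times> R"
  proof clarify
    fix m assume m: "m \<in> H"
    have "jacobi (int (m mod P)) (fermat_number n) = jacobi (int m) (fermat_number n)"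
      if "n \<in> {k..<K}" for n
      unfolding P_def using that by (intro jacobi_mod dvd_prodI) auto
    moreover have "jacobi (int (m mod F)) F = jacobi (int m) F" by (rule jacobi_mod) simp
    ultimately show "m mod P \<in> G \<and> m mod F \<in> R"
      using m P0 step(1) by (auto simp: G_def H_def R_def F_def)
  qed
  moreover have "finite (G \<times> R)" by (simp add: G_def R_def)
  ultimately have "card H \<le> card G * card R"
    using card_inj_on_le by (metis card_cartesian_product)
  then have "2 ^ (Suc K - k) * card H \<le> (2 ^ (K - k) * card G) * (2 * card R)"
    using step(1) by (simp add: Suc_diff_le)
  also have "\<dots> \<le> P * F"
  proof (rule mult_le_mono)
    show "2 ^ (K - k) * card G \<le> P" using step.IH by (simp add: G_def P_def)
    show "2 * card R \<le> F" unfolding R_def F_def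
      by (rule two_card_jacobi_fermat_number_le) (use assms step in simp)
  qed
  finally show ?case using step(1) by (simp add: H_def P_def F_def)
qed

text \<open>For \<open>2 ^ K \<le> y < 2 ^ Suc K\<close> the Fermat numbers from \<open>k\<close> to
  \<open>K - 1\<close> have a product of at most \<open>2 ^ y\<close>. Their conditions leave a
  proportion of at most \<open>1 / 2 ^ (K - k)\<close> in each full block, which is less than
  \<open>2 ^ Suc k / y\<close>.\<close>

lemma card_jacobi_window_le:
  assumes "1 \<le> k" "1 \<le> y"
  shows "y * card {m. m < 2 ^ y \<and> (\<forall>n\<ge>k. jacobi (int m) (fermat_number n) * c n = 1)}
    \<le> 4 * 2 ^ y * 2 ^ k"
proof -
  define W where "W = {m::nat. m < 2 ^ y \<and> (\<forall>n\<ge>k. jacobi (int m) (fermat_number n) * c n = 1)}"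
  obtain K where K: "2 ^ K \<le> y" "y < 2 ^ Suc K" using ex_power_ivl1[of 2 y] assms by auto
  have "y * card W \<le> 4 * 2 ^ y * 2 ^ k"
  proof (cases "k \<le> K")
    \<comment> \<open>Here \<open>y < 2 ^ k\<close>, so the trivial count \<open>2 ^ y\<close> is
      enough.\<close>
    case False
    have "card W \<le> card {..<(2::nat) ^ y}" by (intro card_mono) (auto simp: W_def)
    moreover have "(2::nat) ^ Suc K \<le> 2 ^ k" using False by (intro power_increasing) auto
    ultimately have "y * card W \<le> 2 ^ k * 2 ^ y" using K by (intro mult_le_mono) auto
    also have "\<dots> \<le> 4 * 2 ^ y * 2 ^ k" by simp
    finally show ?thesis .
  next
    case True
    define P where "P = (\<Prod>n=k..<K. fermat_number n)"
    define G where "G = {m. m < P \<and> (\<forall>n\<in>{k..<K}. jacobi (int m) (fermat_number n) * c n = 1)}"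
    \<comment> \<open>At most \<open>B\<close> blocks of length \<open>P\<close> meet the range
      below \<open>2 ^ y\<close>. Rounding up costs a factor of at most 2, since
      \<open>P \<le> 2 ^ y\<close>.\<close>
    define B where "B = 2 ^ y div P + 1"
    have P0: "P > 0" unfolding P_def by (intro prod_pos) simp
    have "P \<le> 2 ^ 2 ^ K" unfolding P_def by (rule prod_fermat_number_interval[OF True])
    also have "(2::nat) ^ 2 ^ K \<le> 2 ^ y" using K by (intro power_increasing) auto
    finally have Py: "P \<le> 2 ^ y" .
    have "inj_on (\<lambda>m. (m mod P, m div P)) W"
      by (rule inj_onI) (metis div_mult_mod_eq prod.inject)
    moreover have "(\<lambda>m. (m mod P, m div P)) ` W \<subseteq> G \<times> {..<B}"
    proof clarify
      fix m assume m: "m \<in> W"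
      have "jacobi (int (m mod P)) (fermat_number n) = jacobi (int m) (fermat_number n)"
        if "n \<in> {k..<K}" for n
        unfolding P_def using that by (intro jacobi_mod dvd_prodI) auto
      moreover have "m div P \<le> 2 ^ y div P" using m by (intro div_le_mono) (simp add: W_def)
      ultimately show "m mod P \<in> G \<and> m div P \<in> {..<B}"
        using m P0 by (auto simp: G_def W_def B_def)
    qed
    moreover have "finite (G \<times> {..<B})" by (simp add: G_def)
    ultimately have W: "card W \<le> card G * B"
      using card_inj_on_le by (metis card_cartesian_product card_lessThan)
    have G: "2 ^ (K - k) * card G \<le> P"
      unfolding G_def P_def by (rule card_jacobi_block_le[OF assms(1) True])
    have "P * (2 ^ y div P) \<le> 2 ^ y" by simp
    then have PB: "P * B \<le> 2 * 2 ^ y" using Py unfolding B_def distrib_left by linarith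
    have "y * card W \<le> 2 ^ Suc K * (card G * B)" using K W by (intro mult_le_mono) auto
    also have "(2::nat) ^ Suc K = 2 * (2 ^ k * 2 ^ (K - k))" using True by (simp flip: power_add)
    also have "2 * (2 ^ k * 2 ^ (K - k)) * (card G * B) = 2 * 2 ^ k * ((2 ^ (K - k) * card G) * B)"
      by (simp add: algebra_simps)
    also have "\<dots> \<le> 2 * 2 ^ k * (P * B)" using G by (intro mult_le_mono) auto
    also have "\<dots> \<le> 2 * 2 ^ k * (2 * 2 ^ y)" using PB by (rule mult_le_mono2)
    also have "\<dots> = 4 * 2 ^ y * 2 ^ k" by simp
    finally show ?thesis .
  qed
  then show ?thesis by (simp add: W_def)
qed

section \<open>Harmonic sums\<close>

lemma sum_inverse_le: "n \<ge> 1 \<Longrightarrow> (\<Sum>j=1..n. 1 / real j) \<le> 1 + ln (real n)"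
proof (induction n rule: dec_induct)
  case (step n)
  have "ln (real n / real (Suc n)) \<le> real n / real (Suc n) - 1"
    using step by (intro ln_le_minus_one) auto
  also have "\<dots> = - 1 / real (Suc n)" by (simp add: field_simps)
  finally have "1 / real (Suc n) \<le> ln (real (Suc n)) - ln (real n)"
    using step by (simp add: ln_div)
  then show ?case using step by simp
qed simp

text \<open>By partial fractions the sum is \<open>1 / X\<close> times two copies of a harmonic sum.
  The denominators \<open>i\<close> and \<open>X - i\<close> will come from counting primes and
  cofactors.\<close>

lemma sum_inverse_mult_le:
  assumes "X \<ge> 2"
  shows "(\<Sum>i=1..<X. 1 / (real i * real (X - i))) \<le> 2 * (1 + ln (real X)) / real X"
proof -
  have "(\<Sum>i=1..<X. 1 / real (X - i)) = (\<Sum>i=1..<X. 1 / real i)"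
    by (rule sum.reindex_bij_witness[of _ "\<lambda>i. X - i" "\<lambda>i. X - i"]) auto
  moreover have "1 / (real i * real (X - i)) = (1 / real i + 1 / real (X - i)) / real X"
    if "i \<in> {1..<X}" for i
    using that by (simp add: field_simps of_nat_diff)
  then have "(\<Sum>i=1..<X. 1 / (real i * real (X - i)))
      = (\<Sum>i=1..<X. (1 / real i + 1 / real (X - i)) / real X)"
    by (intro sum.cong) auto
  ultimately have "(\<Sum>i=1..<X. 1 / (real i * real (X - i))) = 2 * (\<Sum>i=1..<X. 1 / real i) / real X"
    by (simp add: sum.distrib flip: sum_divide_distrib)
  moreover have "(\<Sum>i=1..<X. 1 / real i) \<le> (\<Sum>i=1..X. 1 / real i)"
    by (intro sum_mono2) auto
  moreover have "(\<Sum>i=1..X. 1 / real i) \<le> 1 + ln (real X)"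
    using assms by (intro sum_inverse_le) simp
  ultimately show ?thesis by (simp add: divide_right_mono)
qed

section \<open>Decomposition and count of the anti-elite numbers\<close>

definition progression_primes :: "nat \<Rightarrow> nat \<Rightarrow> nat set" where
  "progression_primes i k = {p. prime p \<and> 2 ^ k dvd p - 1 \<and> 2 ^ i \<le> p \<and> p < 2 ^ Suc i}"

text \<open>The product of the two symbols is that of \<open>p * m\<close>. Kept apart, the symbol
  of \<open>p\<close> serves as the \<open>c n\<close> of
  \<open>card_jacobi_window_le\<close>.\<close>

definition jacobi_window :: "nat \<Rightarrow> nat \<Rightarrow> nat \<Rightarrow> nat set" where
  "jacobi_window y k p = {m. m < 2 ^ y \<and>
    (\<forall>n\<ge>Suc k. jacobi (int m) (fermat_number n) * jacobi (int p) (fermat_number n) = 1)}"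

text \<open>The odd prime factor \<open>p\<close> is chosen with \<open>p - 1\<close> of largest 2-adic valuation \<open>k\<close>, and
  \<open>2 ^ i \<le> p < 2 ^ Suc i\<close>; then \<open>m = A div p\<close> has Jacobi symbols prescribed by \<open>p\<close> already
  from \<open>n = k + 1\<close> on.\<close>

lemma anti_elite_decomposition:
  assumes A: "anti_elite A" "A \<le> 2 ^ X"
  shows "A \<in> (\<lambda>a. 2 ^ a) ` {..X}
    \<union> (\<Union>k\<in>{1..<K}. \<Union>i\<in>{k..<X}. \<Union>p\<in>progression_primes i k. (*) p ` jacobi_window (X - i) k p)
    \<union> (\<Union>j\<in>{1..2 ^ X}. {B\<in>{1..2 ^ X}. 2 ^ K * j + 1 dvd B})"
proof -
  have A0: "A > 0" using A by (simp add: anti_elite_def)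
  define D where "D = {p. prime p \<and> p dvd A \<and> 2 < p}"
  have "D \<subseteq> {..A}" using A0 by (auto simp: D_def intro: dvd_imp_le)
  then have finD: "finite D" using finite_subset by blast
  show ?thesis
  proof (cases "D = {}")
    case True
    have "\<not> is_unit (2 :: nat)" by simp
    then obtain d where d: "A = 2 ^ multiplicity 2 A * d" "\<not> 2 dvd d"
      using multiplicity_decompose'[of A 2] A0 by blast
    define a where "a = multiplicity 2 A"
    have Aa: "A = 2 ^ a * d" using d(1) by (simp add: a_def)
    have "d = 1"
    proof (rule ccontr)
      assume "d \<noteq> 1"
      then obtain p where p: "prime p" "p dvd d" using prime_factor_nat by blast
      then have "p \<noteq> 2" using d(2) by blast
      then have "2 < p" using prime_ge_2_nat[OF p(1)] by simp
      then show False using True p Aa by (auto simp: D_def)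
    qed
    then have "A = 2 ^ a" using Aa by simp
    moreover from this have "(2::nat) ^ a \<le> 2 ^ X" using A by simp
    then have "a \<le> X" by (rule power_le_imp_le_exp[rotated]) simp
    ultimately show ?thesis by blast
  next
    case False
    define v where "v p = multiplicity 2 (p - 1)" for p :: nat
    have "Max (v ` D) \<in> v ` D" using finD False by (intro Max_in) auto
    then obtain p where pD: "p \<in> D" and pmax: "v p = Max (v ` D)" by auto
    define k where "k = v p"
    have vk: "v q \<le> k" if "q \<in> D" for q using that finD by (simp add: k_def pmax)
    have p: "prime p" "p dvd A" "2 < p" using pD by (simp_all add: D_def)
    have kp: "2 ^ k dvd p - 1" by (simp add: k_def v_def multiplicity_dvd)
    have "odd p" using prime_odd_nat p by blast
    define m where "m = A div p"
    have Apm: "A = p * m" using p by (simp add: m_def)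
    show ?thesis
    proof (cases "k < K")
      case False
      then have "2 ^ K dvd p - 1" using kp by (meson dvd_trans le_imp_power_dvd not_less)
      then obtain j where j: "p - 1 = 2 ^ K * j" by blast
      have pj: "p = 2 ^ K * j + 1" using j p by simp
      have "j \<noteq> 0" using pj p by (intro notI) simp
      moreover have "j \<le> 2 ^ K * j" by simp
      then have "j \<le> 2 ^ X" using pj dvd_imp_le[OF p(2) A0] A by linarith
      ultimately have "j \<in> {1..2 ^ X}" by simp
      moreover have "A \<in> {B\<in>{1..2 ^ X}. 2 ^ K * j + 1 dvd B}" using A A0 p pj by simp
      ultimately show ?thesis by blast
    next
      case True
      have "p - 1 \<noteq> 0" "\<not> is_unit (2 :: nat)" "2 ^ 1 dvd p - 1" using p \<open>odd p\<close> by auto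
      then have "k \<ge> 1" unfolding k_def v_def by (intro multiplicity_geI) auto
      obtain i where i: "2 ^ i \<le> p" "p < 2 ^ Suc i"
        using ex_power_ivl1[of 2 p] p by auto
      have "2 ^ k < (2::nat) ^ Suc i" using dvd_imp_le[OF kp] p i by linarith
      then have "k \<le> i" by (simp only: power_strict_increasing_iff)
      have "m > 0" using A0 Apm by (cases m) auto
      have "i \<noteq> 0" using \<open>k \<ge> 1\<close> \<open>k \<le> i\<close> by simp
      then have "even ((2::nat) ^ i)" by simp
      \<comment> \<open>Strictness yields \<open>m < 2 ^ (X - i)\<close> and also
        \<open>i < X\<close>, so that the window has a positive exponent.\<close>
      then have "2 ^ i < p" using i(1) \<open>odd p\<close> by (cases "2 ^ i = p") auto
      then have "2 ^ i * m < p * m" using \<open>m > 0\<close> by simp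
      then have im: "2 ^ i * m < 2 ^ X" using A(2) unfolding Apm by (rule less_le_trans)
      have "2 ^ i * 1 \<le> 2 ^ i * m" using \<open>m > 0\<close> by (intro mult_le_mono) auto
      then have "2 ^ i < (2::nat) ^ X" using im by linarith
      then have "i < X" by simp
      then have "(2::nat) ^ X = 2 ^ i * 2 ^ (X - i)" by (simp flip: power_add)
      then have "m < 2 ^ (X - i)" using im by simp
      moreover have "jacobi (int m) (fermat_number n) * jacobi (int p) (fermat_number n) = 1"
        if "n \<ge> Suc k" for n
      proof -
        \<comment> \<open>Maximality of \<open>k\<close> allows the threshold \<open>Suc k\<close>,
          which is at least 2, as \<open>anti_elite_jacobi\<close> demands, because
          \<open>k \<ge> 1\<close>.\<close>
        have "\<not> 2 ^ Suc (Suc k) dvd q - 1" if "prime q" "q dvd A" "2 < q" for q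
        proof
          assume "2 ^ Suc (Suc k) dvd q - 1"
          then have "Suc (Suc k) \<le> v q" unfolding v_def using that
            by (intro multiplicity_geI) auto
          then show False using vk[of q] that by (simp add: D_def)
        qed
        then have "jacobi (int A) (fermat_number n) = 1"
          using \<open>k \<ge> 1\<close> that by (intro anti_elite_jacobi[OF A(1), of "Suc k"]) auto
        then show ?thesis using Apm by (simp add: jacobi_mult mult.commute)
      qed
      ultimately have "m \<in> jacobi_window (X - i) k p" by (simp add: jacobi_window_def)
      moreover have "p \<in> progression_primes i k"
        using p kp i by (simp add: progression_primes_def)
      ultimately show ?thesis using Apm \<open>k \<ge> 1\<close> True \<open>k \<le> i\<close> \<open>i < X\<close> by fastforce
    qed
  qed
qed

text \<open>A union bound over the primes. The factor \<open>2 ^ Suc k\<close> of the window bound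
  is offset by the sparsity of the progression: the three exponents of 2 add up to
  \<open>X + 2\<close>, whatever \<open>i\<close> and \<open>k\<close> are.\<close>

lemma card_progression_primes_windows_le:
  assumes "1 \<le> k" "k \<le> i" "i < X"
  shows "real (card (\<Union>p\<in>progression_primes i k. (*) p ` jacobi_window (X - i) k p))
    \<le> 16 * (real k + 2) * 2 ^ X * (1 / (real i * real (X - i)))"
proof -
  have fin: "finite (progression_primes i k)"
    by (rule finite_subset[of _ "{..<2 ^ Suc i}"]) (auto simp: progression_primes_def)
  have finw: "finite (jacobi_window y k p)" for y p by (simp add: jacobi_window_def)
  define w :: real where "w = 4 * 2 ^ (X - i) * 2 ^ Suc k / real (X - i)"
  have w: "real (card ((*) p ` jacobi_window (X - i) k p)) \<le> w" for p
  proof -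
    have "real ((X - i) * card (jacobi_window (X - i) k p))
        \<le> real (4 * 2 ^ (X - i) * 2 ^ Suc k)"
      unfolding jacobi_window_def of_nat_le_iff
      by (rule card_jacobi_window_le) (use assms in auto)
    then have "real (card (jacobi_window (X - i) k p)) \<le> w"
      unfolding w_def using assms by (subst pos_le_divide_eq) (simp_all add: mult.commute)
    moreover have "card ((*) p ` jacobi_window (X - i) k p) \<le> card (jacobi_window (X - i) k p)"
      using finw by (rule card_image_le)
    ultimately show ?thesis by linarith
  qed
  have P: "real (card (progression_primes i k)) \<le> (real k + 2) * 2 ^ (Suc i - k) / real i"
  proof -
    have "real (i * card (progression_primes i k)) \<le> real ((k + 2) * 2 ^ (Suc i - k))"
      unfolding progression_primes_def of_nat_le_iff
      by (rule card_primes_progression_dyadic) (use assms in auto)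
    then show ?thesis using assms by (simp add: field_simps)
  qed
  have "real (card (\<Union>p\<in>progression_primes i k. (*) p ` jacobi_window (X - i) k p))
      \<le> (\<Sum>p\<in>progression_primes i k. real (card ((*) p ` jacobi_window (X - i) k p)))"
    unfolding of_nat_sum[symmetric] of_nat_le_iff using fin by (rule card_UN_le)
  also have "\<dots> \<le> (\<Sum>p\<in>progression_primes i k. w)" by (intro sum_mono w)
  also have "\<dots> = real (card (progression_primes i k)) * w" by simp
  also have "\<dots> \<le> (real k + 2) * 2 ^ (Suc i - k) / real i * w"
    using P by (intro mult_right_mono) (simp_all add: w_def)
  also have "\<dots> = 4 * (real k + 2) * (2 ^ (Suc i - k) * 2 ^ (X - i) * 2 ^ Suc k) * (1 / (real i * real (X - i)))"
    by (simp add: w_def)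
  also have "2 ^ (Suc i - k) * 2 ^ (X - i) * 2 ^ Suc k = (4 * 2 ^ X :: real)"
  proof -
    have "Suc i - k + (X - i) + Suc k = X + 2" using assms by simp
    then have "2 ^ (Suc i - k) * 2 ^ (X - i) * 2 ^ Suc k = (2::real) ^ (X + 2)"
      by (simp only: flip: power_add)
    then show ?thesis by simp
  qed
  finally show ?thesis by (simp add: algebra_simps)
qed

lemma card_multiples_le:
  fixes d N :: nat
  assumes "d > 0"
  shows "real (card {B\<in>{1..N}. d dvd B}) \<le> real N / real d"
proof -
  have "{B\<in>{1..N}. d dvd B} \<subseteq> (*) d ` {1..N div d}"
  proof
    fix B assume "B \<in> {B\<in>{1..N}. d dvd B}"
    then obtain t where t: "B = d * t" "1 \<le> B" "B \<le> N" by auto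
    then have "t \<ge> 1" by (cases t) auto
    moreover have "t \<le> N div d" using t assms by (simp add: less_eq_div_iff_mult_less_eq mult.commute)
    ultimately show "B \<in> (*) d ` {1..N div d}" using t by auto
  qed
  then have "card {B\<in>{1..N}. d dvd B} \<le> card ((*) d ` {1..N div d})" by (intro card_mono) auto
  also have "\<dots> \<le> N div d" using card_image_le[of "{1..N div d}" "(*) d"] by simp
  finally have "card {B\<in>{1..N}. d dvd B} * d \<le> N div d * d" by (rule mult_le_mono1)
  also have "\<dots> \<le> N" by simp
  finally have "real (card {B\<in>{1..N}. d dvd B} * d) \<le> real N" by (simp only: of_nat_le_iff)
  then show ?thesis using assms by (subst pos_le_divide_eq) simp_all
qed

text \<open>A union bound over the three sets of \<open>anti_elite_decomposition\<close>, with one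
  group of terms for each. \<open>K\<close> stays free: the middle term grows with it and the last
  one shrinks.\<close>

lemma card_anti_elite_le:
  assumes "X \<ge> 2"
  shows "real (card {A. 1 < A \<and> A \<le> 2 ^ X \<and> anti_elite A})
    \<le> real X + 1 + 32 * real K * (real K + 2) * 2 ^ X * (1 + ln (real X)) / real X
      + 2 ^ X * (1 + real X) / 2 ^ K"
proof -
  define S1 :: "nat set" where "S1 = (\<lambda>a. 2 ^ a) ` {..X}"
  define U where "U k i = (\<Union>p\<in>progression_primes i k. (*) p ` jacobi_window (X - i) k p)" for k i
  define S2 where "S2 = (\<Union>k\<in>{1..<K}. \<Union>i\<in>{k..<X}. U k i)"
  define V where "V j = {B\<in>{1..2 ^ X}. 2 ^ K * j + 1 dvd B}" for j :: nat
  define S3 where "S3 = (\<Union>j\<in>{1..2 ^ X}. V j)"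
  have finU: "finite (U k i)" for k i
  proof -
    have "finite (progression_primes i k)"
      by (rule finite_subset[of _ "{..<2 ^ Suc i}"]) (auto simp: progression_primes_def)
    then show ?thesis by (auto simp: U_def jacobi_window_def)
  qed
  have fin: "finite S1" "finite S2" "finite S3"
    by (auto simp: S1_def S2_def S3_def V_def intro: finU)
  have "{A. 1 < A \<and> A \<le> 2 ^ X \<and> anti_elite A} \<subseteq> S1 \<union> S2 \<union> S3"
    using anti_elite_decomposition[of _ X K]
    by (auto simp only: S1_def S2_def S3_def U_def V_def)
  then have "card {A. 1 < A \<and> A \<le> 2 ^ X \<and> anti_elite A} \<le> card (S1 \<union> S2 \<union> S3)"
    using fin by (intro card_mono) auto
  also have "\<dots> \<le> card S1 + card S2 + card S3"
    by (meson card_Un_le add_le_mono1 order_trans)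
  finally have main: "real (card {A. 1 < A \<and> A \<le> 2 ^ X \<and> anti_elite A})
      \<le> real (card S1) + real (card S2) + real (card S3)" by linarith
  have c1: "real (card S1) \<le> real X + 1"
    using card_image_le[of "{..X}" "\<lambda>a. (2::nat) ^ a"] by (simp add: S1_def)
  have c2: "real (card S2) \<le> 32 * real K * (real K + 2) * 2 ^ X * (1 + ln (real X)) / real X"
  proof -
    define h where "h = 2 * (1 + ln (real X)) / real X"
    have h0: "h \<ge> 0" using assms by (simp add: h_def)
    have "card S2 \<le> (\<Sum>k\<in>{1..<K}. card (\<Union>i\<in>{k..<X}. U k i))"
      unfolding S2_def by (rule card_UN_le) simp
    also have "\<dots> \<le> (\<Sum>k\<in>{1..<K}. \<Sum>i\<in>{k..<X}. card (U k i))"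
      by (intro sum_mono card_UN_le) simp
    finally have "real (card S2) \<le> (\<Sum>k\<in>{1..<K}. \<Sum>i\<in>{k..<X}. real (card (U k i)))"
      unfolding of_nat_sum[symmetric] of_nat_le_iff .
    also have "\<dots> \<le> (\<Sum>k\<in>{1..<K}. 16 * (real K + 2) * 2 ^ X * h)"
    proof (intro sum_mono)
      fix k assume k: "k \<in> {1..<K}"
      have "(\<Sum>i\<in>{k..<X}. real (card (U k i)))
          \<le> (\<Sum>i\<in>{k..<X}. 16 * (real k + 2) * 2 ^ X * (1 / (real i * real (X - i))))"
        unfolding U_def using k by (intro sum_mono card_progression_primes_windows_le) auto
      also have "\<dots> = 16 * (real k + 2) * 2 ^ X * (\<Sum>i\<in>{k..<X}. 1 / (real i * real (X - i)))"
        by (rule sum_distrib_left[symmetric])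
      also have "\<dots> \<le> 16 * (real K + 2) * 2 ^ X * h"
      proof (intro mult_mono)
        have "(\<Sum>i\<in>{k..<X}. 1 / (real i * real (X - i))) \<le> (\<Sum>i=1..<X. 1 / (real i * real (X - i)))"
          using k by (intro sum_mono2) auto
        also have "\<dots> \<le> h" unfolding h_def by (rule sum_inverse_mult_le[OF assms])
        finally show "(\<Sum>i\<in>{k..<X}. 1 / (real i * real (X - i))) \<le> h" .
      qed (use k in \<open>auto intro: sum_nonneg\<close>)
      finally show "(\<Sum>i\<in>{k..<X}. real (card (U k i))) \<le> 16 * (real K + 2) * 2 ^ X * h" .
    qed
    also have "\<dots> = real (K - 1) * (16 * (real K + 2) * 2 ^ X * h)" by simp
    also have "\<dots> \<le> real K * (16 * (real K + 2) * 2 ^ X * h)"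
      using h0 by (intro mult_right_mono) auto
    also have "\<dots> = 32 * real K * (real K + 2) * 2 ^ X * (1 + ln (real X)) / real X"
      by (simp add: h_def) (simp add: algebra_simps)
    finally show ?thesis .
  qed
  have c3: "real (card S3) \<le> 2 ^ X * (1 + real X) / 2 ^ K"
  proof -
    have "card S3 \<le> (\<Sum>j\<in>{1..2 ^ X}. card (V j))" unfolding S3_def by (rule card_UN_le) simp
    then have "real (card S3) \<le> (\<Sum>j\<in>{1..2 ^ X}. real (card (V j)))"
      unfolding of_nat_sum[symmetric] of_nat_le_iff .
    also have "\<dots> \<le> (\<Sum>j\<in>{1..2 ^ X}. 2 ^ X / 2 ^ K * (1 / real j))"
    proof (intro sum_mono)
      fix j :: nat assume j: "j \<in> {1..2 ^ X}"
      have "real (card (V j)) \<le> real (2 ^ X) / real (2 ^ K * j + 1)"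
        unfolding V_def by (rule card_multiples_le) simp
      also have "\<dots> \<le> 2 ^ X / (2 ^ K * real j)" using j
        by (auto intro!: divide_left_mono mult_pos_pos add_pos_pos)
      finally show "real (card (V j)) \<le> 2 ^ X / 2 ^ K * (1 / real j)" by simp
    qed
    also have "\<dots> = 2 ^ X / 2 ^ K * (\<Sum>j\<in>{1..2 ^ X}. 1 / real j)"
      by (rule sum_distrib_left[symmetric])
    also have "\<dots> \<le> 2 ^ X / 2 ^ K * (1 + real X)"
    proof (intro mult_left_mono)
      have "(\<Sum>j\<in>{1..2 ^ X}. 1 / real j) \<le> 1 + ln (real (2 ^ X))"
        by (rule sum_inverse_le) simp
      also have "ln (real (2 ^ X)) = real X * ln 2" by (simp add: ln_realpow)
      also have "\<dots> \<le> real X" using ln_2_less_1 by (intro mult_left_le) auto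
      finally show "(\<Sum>j\<in>{1..2 ^ X}. 1 / real j) \<le> 1 + real X" by simp
    qed simp
    finally show ?thesis by simp
  qed
  show ?thesis using main c1 c2 c3 by linarith
qed

text \<open>In the preceding lemma, \<open>K\<close> is taken to be about \<open>2 log\<^sub>2 X\<close>: then \<open>2 ^ K \<ge> X\<^sup>2\<close>,
  and \<open>K\<close> contributes only powers of \<open>ln X\<close>.\<close>

lemma card_anti_elite_power_2_le:
  fixes \<delta> :: real
  assumes "0 < \<delta>" "\<delta> < 1"
  shows "\<forall>\<^sub>F X in sequentially. real (card {A. 1 < A \<and> A \<le> 2 ^ X \<and> anti_elite A})
    \<le> 2 ^ X * real X powr (\<delta> - 1)"
proof -
  \<comment> \<open>\<open>f\<close> is the upper bound for \<open>K = 2 * Suc L\<close>, where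
    \<open>2 ^ L \<le> X\<close>. The bound of \<open>card_anti_elite_le\<close> is divided by
    \<open>2 ^ X\<close>; what remains is of order \<open>(ln x) ^ 3 / x\<close>.\<close>
  define f :: "real \<Rightarrow> real" where "f x = 2 + 2 * log 2 x" for x
  have "((\<lambda>x. (x + 1) * 2 powr - x + 32 * f x * (f x + 2) * (1 + ln x) / x + (1 + x) / x ^ 2)
      \<in> o[at_top](\<lambda>x. x powr (\<delta> - 1)))"
    using assms unfolding f_def by real_asymp
  then have "\<forall>\<^sub>F x in at_top.
      norm ((x + 1) * 2 powr - x + 32 * f x * (f x + 2) * (1 + ln x) / x + (1 + x) / x ^ 2)
        \<le> 1 * norm (x powr (\<delta> - 1))"
    by (rule landau_o.smallD) simp
  then have "\<forall>\<^sub>F X in sequentially.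
      norm ((real X + 1) * 2 powr - real X + 32 * f (real X) * (f (real X) + 2) * (1 + ln (real X)) / real X
        + (1 + real X) / real X ^ 2) \<le> 1 * norm (real X powr (\<delta> - 1))"
    using filterlim_real_sequentially eventually_compose_filterlim by blast
  then show ?thesis using eventually_ge_at_top[of 2]
  proof eventually_elim
    case (elim X)
    obtain L where L: "2 ^ L \<le> X" "X < 2 ^ Suc L" using ex_power_ivl1[of 2 X] elim by auto
    define K where "K = 2 * Suc L"
    have "real L \<le> log 2 (real X)"
      using L(1) elim by (simp add: le_log_iff powr_realpow)
    then have Kf: "real K \<le> f (real X)" by (simp add: K_def f_def)
    have "X ^ 2 \<le> (2 ^ Suc L) ^ 2" using L by (intro power_mono) auto
    also have "\<dots> = 2 ^ K" unfolding K_def by (simp only: power_mult mult.commute)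
    finally have "real (X ^ 2) \<le> real (2 ^ K)" by (simp only: of_nat_le_iff)
    then have KX: "real X ^ 2 \<le> 2 ^ K" by simp
    have lnX: "ln (real X) \<ge> 0" using elim by simp
    have "real (card {A. 1 < A \<and> A \<le> 2 ^ X \<and> anti_elite A})
      \<le> real X + 1 + 32 * real K * (real K + 2) * 2 ^ X * (1 + ln (real X)) / real X
        + 2 ^ X * (1 + real X) / 2 ^ K"
      using elim by (intro card_anti_elite_le) simp
    also have "\<dots> \<le> real X + 1 + 32 * f (real X) * (f (real X) + 2) * 2 ^ X * (1 + ln (real X)) / real X
        + 2 ^ X * (1 + real X) / real X ^ 2"
      using Kf KX lnX elim
      by (intro add_mono divide_right_mono mult_right_mono mult_mono divide_left_mono mult_pos_pos) auto
    also have "\<dots> = 2 ^ X * ((real X + 1) * 2 powr - real X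
        + 32 * f (real X) * (f (real X) + 2) * (1 + ln (real X)) / real X + (1 + real X) / real X ^ 2)"
      by (simp add: algebra_simps powr_minus powr_realpow)
    also have "\<dots> \<le> 2 ^ X * real X powr (\<delta> - 1)"
      using elim by (intro mult_left_mono) auto
    finally show ?case .
  qed
qed

section \<open>Passage from powers of 2 to all real x\<close>

theorem theorem3p2:
  shows "\<forall>\<epsilon>::real. \<epsilon> > 0 \<longrightarrow>
    (\<exists>x\<^sub>0 C :: real. \<forall>x::real. x > x\<^sub>0 \<longrightarrow>
      real (card {A::nat. 1 < A \<and> real A \<le> x \<and> anti_elite A})
        \<le> C * (x / ln x powr (1 - \<epsilon>)))"
proof (intro allI impI)
  fix \<epsilon> :: real assume "\<epsilon> > 0"
  \<comment> \<open>The cap below 1 makes \<open>t powr (\<delta> - 1)\<close> decreasing in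
    \<open>t\<close>, so that \<open>X\<close> can be replaced by the smaller \<open>ln x\<close>.
    Returning to \<open>\<epsilon>\<close> only weakens the bound, as
    \<open>ln x \<ge> 1\<close>.\<close>
  define \<delta> where "\<delta> = min \<epsilon> (1 / 2)"
  have \<delta>: "0 < \<delta>" "\<delta> < 1" "\<delta> \<le> \<epsilon>" using \<open>\<epsilon> > 0\<close> by (auto simp: \<delta>_def)
  obtain X0 where X0: "\<And>X. X \<ge> X0 \<Longrightarrow> real (card {A. 1 < A \<and> A \<le> 2 ^ X \<and> anti_elite A})
      \<le> 2 ^ X * real X powr (\<delta> - 1)"
    using card_anti_elite_power_2_le[OF \<delta>(1,2)] by (auto simp: eventually_sequentially)
  \<comment> \<open>The first summand ensures \<open>X \<ge> X0\<close> for the exponent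
    \<open>X\<close> chosen below, the second \<open>ln x \<ge> 1\<close>.\<close>
  define x0 :: real where "x0 = 2 ^ X0 + exp 1"
  have "real (card {A::nat. 1 < A \<and> real A \<le> x \<and> anti_elite A}) \<le> 2 * (x / ln x powr (1 - \<epsilon>))"
    if "x > x0" for x
  proof -
    have x: "x > 2 ^ X0" "x > exp 1"
      using that exp_gt_zero[of "1::real"] unfolding x0_def by (smt (verit) zero_less_power)+
    then have "x > 1" using one_less_exp_iff[of "1::real"] by linarith
    have ln1: "ln x \<ge> 1" using x \<open>x > 1\<close> by (simp add: ln_ge_iff)
    \<comment> \<open>\<open>2 ^ X\<close> is the least power of 2 that is at least
      \<open>x\<close>; it is at most \<open>2 * x\<close>, which gives the constant 2.\<close>
    define X where "X = nat \<lceil>log 2 x\<rceil>"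
    have "log 2 x > 0" using \<open>x > 1\<close> by simp
    then have X: "log 2 x \<le> real X" "real X < log 2 x + 1" unfolding X_def by linarith+
    have xX: "x \<le> 2 ^ X" using X(1) \<open>x > 1\<close> by (simp add: log_le_iff powr_realpow)
    have "2 powr real X \<le> 2 powr (log 2 x + 1)" using X by (intro powr_mono) auto
    then have Xx: "2 ^ X \<le> 2 * x" using \<open>x > 1\<close> by (simp add: powr_add powr_realpow)
    have "(2::real) ^ X0 < 2 ^ X" using x xX by linarith
    then have "X \<ge> X0" by simp
    have "ln x \<le> log 2 x" using ln_2_less_1 ln1 by (simp add: log_def le_divide_eq mult_left_le)
    then have lnX: "ln x \<le> real X" using X by linarith
    have "real (card {A::nat. 1 < A \<and> real A \<le> x \<and> anti_elite A})
        \<le> real (card {A. 1 < A \<and> A \<le> 2 ^ X \<and> anti_elite A})"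
    proof -
      have "A \<le> 2 ^ X" if "real A \<le> x" for A :: nat
      proof -
        have "real (2 ^ X) = (2::real) ^ X" by simp
        then show ?thesis using that xX by (metis of_nat_le_iff order_trans)
      qed
      then have "{A::nat. 1 < A \<and> real A \<le> x \<and> anti_elite A} \<subseteq> {A. 1 < A \<and> A \<le> 2 ^ X \<and> anti_elite A}"
        by blast
      moreover have "finite {A::nat. 1 < A \<and> A \<le> 2 ^ X \<and> anti_elite A}"
        by (rule finite_subset[of _ "{..2 ^ X}"]) auto
      ultimately show ?thesis by (simp add: card_mono)
    qed
    also have "\<dots> \<le> 2 ^ X * real X powr (\<delta> - 1)" by (rule X0[OF \<open>X \<ge> X0\<close>])
    also have "\<dots> \<le> 2 * x * ln x powr (\<delta> - 1)"
      using Xx lnX ln1 \<delta> \<open>x > 1\<close> by (intro mult_mono powr_mono2') auto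
    also have "\<dots> \<le> 2 * x * ln x powr (\<epsilon> - 1)"
      using ln1 \<delta> \<open>x > 1\<close> by (intro mult_left_mono powr_mono) auto
    also have "\<dots> = 2 * (x / ln x powr (1 - \<epsilon>))"
      using powr_minus_divide[of "ln x" "1 - \<epsilon>"] by simp
    finally show ?thesis .
  qed
  then show "\<exists>x\<^sub>0 C :: real. \<forall>x::real. x > x\<^sub>0 \<longrightarrow>
      real (card {A::nat. 1 < A \<and> real A \<le> x \<and> anti_elite A})
        \<le> C * (x / ln x powr (1 - \<epsilon>))" by blast
qed

end
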